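(* Let $0<p<q<\infty$ and let $f,g$ be random variables such that $\|f\|_\Phi\le\|g\|_\Phi$ for all $\Phi\in F_q\cap G_p$. If $X$ is a $(p,q)$-$K$-interpolation space, then $$\|f\|_X\le 2^{2+1/p}\,C_{p,q}(X)\,\|g\|_X.$$
   Context: Decreasing rearrangement: for a random variable $f$, $f^{\#}(s)=\sup\{t: P(|f|>t)>s\}$, $s\in[0,1]$ (taken as $0$ where the set contains no $t\ge 0$). Class $F_q$ ($q>0$): all functions $\Phi:[0,\infty)\to[0,\infty)$ with $\Phi(0)=0$, $\Phi$ nondecreasing and continuous, and $\Phi(cx)\le c^q\Phi(x)$ for all $x\ge0$, $c\ge2$. Class $G_p$ ($p>0$): all functions $\Phi:[0,\infty)\to[0,\infty)$ with $\Phi(0)=0$, $\Phi$ nondecreasing and continuous, and $\Phi(cx)\ge c^p\Phi(x)$ for all $x\ge0$, $c\ge2$. Orlicz norm: $\|f\|_\Phi=\inf\{\lambda>0: E(\Phi(|f|/\lambda))\le1\}$ (equal to $\infty$ if no such $\lambda$ exists). A rearrangement invariant space $X$ is a space of random variables equipped with a complete quasi-norm $\|\cdot\|_X$ such that either (i), (ii), (iii) or (i), (ii), (iii$'$) hold: (i) if $g^{\#}\le f^{\#}$ and $f\in X$, then $g\in X$ with $\|g\|_X\le\|f\|_X$; (ii) if $f$ is simple with finite support then $f\in X$; (iii) $f_n\in X$ and $f_n\searrow0$ implies $\|f_n\|_X\searrow0$; (iii$'$) $f_n\in X$, $0\le f_n\nearrow f$ and $\sup_n\|f_n\|_X<\infty$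 imply $f\in X$ with $\|f\|_X=\sup_n\|f_n\|_X$. We put $\|f\|_X=\infty$ if $f\notin X$. For $t>0$, $K_{p,q}(f,t)=\inf\{\|f'\|_p+t\|f''\|_q: f'+f''=f^{\#}\}$, where $f',f''$ are measurable functions on $[0,1]$ and $\|\cdot\|_p,\|\cdot\|_q$ are the $L_p,L_q$ (quasi-)norms on $[0,1]$ with Lebesgue measure. A rearrangement invariant space $X$ is a $(p,q)$-$K$-interpolation space if there is a constant $c$ such that whenever $f,g$ satisfy $K_{p,q}(f,t)\le K_{p,q}(g,t)$ for all $t>0$ and $g\in X$, then $f\in X$ and $\|f\|_X\le c\|g\|_X$. The $(p,q)$-$K$-interpolation constant $C_{p,q}(X)$ is the infimum of the $c$ that work for all $f$ and $g$. *)

theory Defs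
  imports "HOL-Probability.Probability"
begin

(* The supremum is taken in ennreal: it is 0 for the empty set, and the value
   at s = 0 (the essential supremum of |f|) may be infinite. *)
definition rearr :: "'a measure \<Rightarrow> ('a \<Rightarrow> real) \<Rightarrow> real \<Rightarrow> ennreal" where
  "rearr M f s = (SUP t\<in>{t. 0 \<le> t \<and> measure M {x \<in> space M. \<bar>f x\<bar> > t} > s}. ennreal t)"

(* Functions from [0,\<infinity>) to [0,\<infinity>) are represented by functions on the reals of which
   only the restriction to {0..} matters. *)
definition growth_fun :: "(real \<Rightarrow> real) \<Rightarrow> bool" where
  "growth_fun \<Phi> \<longleftrightarrow>
     (\<forall>x\<ge>0. 0 \<le> \<Phi> x) \<and> \<Phi> 0 = 0 \<and> mono_on {0..} \<Phi> \<and> continuous_on {0..} \<Phi>"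

definition F_class :: "real \<Rightarrow> (real \<Rightarrow> real) set" where
  "F_class q = {\<Phi>. growth_fun \<Phi> \<and> (\<forall>x\<ge>0. \<forall>c\<ge>2. \<Phi> (c * x) \<le> c powr q * \<Phi> x)}"

definition G_class :: "real \<Rightarrow> (real \<Rightarrow> real) set" where
  "G_class p = {\<Phi>. growth_fun \<Phi> \<and> (\<forall>x\<ge>0. \<forall>c\<ge>2. \<Phi> (c * x) \<ge> c powr p * \<Phi> x)}"

definition orlicz_norm :: "'a measure \<Rightarrow> (real \<Rightarrow> real) \<Rightarrow> ('a \<Rightarrow> real) \<Rightarrow> ennreal" where
  "orlicz_norm M \<Phi> f =
     (INF r\<in>{r. r > 0 \<and> (\<integral>\<^sup>+x. ennreal (\<Phi> (\<bar>f x\<bar> / r)) \<partial>M) \<le> 1}. ennreal r)"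

definition Lp_qnorm :: "'a measure \<Rightarrow> real \<Rightarrow> ('a \<Rightarrow> real) \<Rightarrow> ennreal" where
  "Lp_qnorm M p h =
     (let I = \<integral>\<^sup>+x. ennreal (\<bar>h x\<bar> powr p) \<partial>M
      in if I = \<infinity> then \<infinity> else ennreal (enn2real I powr (1 / p)))"

abbreviation unit_interval_measure :: "real measure" where
  "unit_interval_measure \<equiv> lebesgue_on {0..1}"

(* The identity f' + f'' = rearr f is required almost everywhere, since rearr f may be
   infinite at 0. The components f', f'' may take negative values, so the identity is
   stated in ereal: ennreal would truncate a negative sum to 0. *)
definition K_functional ::
    "'a measure \<Rightarrow> real \<Rightarrow> real \<Rightarrow> ('a \<Rightarrow> real) \<Rightarrow> real \<Rightarrow> ennreal" where
  "K_functional M p q f t =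
     (INF (f', f'')\<in>{(f', f''). f' \<in> borel_measurable unit_interval_measure \<and>
                               f'' \<in> borel_measurable unit_interval_measure \<and>
                               (AE s in unit_interval_measure.
                                  ereal (f' s + f'' s) = enn2ereal (rearr M f s))}.
        Lp_qnorm unit_interval_measure p f'
          + ennreal t * Lp_qnorm unit_interval_measure q f'')"

(* A space of random variables is a set X of measurable functions together with a
   function N, of which only the values on X matter. Elements are functions
   rather than almost-everywhere classes; accordingly N vanishes exactly on
   the functions that are almost everywhere 0. *)
definition quasi_normed_rv_space ::
    "'a measure \<Rightarrow> ('a \<Rightarrow> real) set \<Rightarrow> (('a \<Rightarrow> real) \<Rightarrow> real) \<Rightarrow> bool" where
  "quasi_normed_rv_space M X N \<longleftrightarrow>
     X \<subseteq> borel_measurable M \<and>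
     (\<lambda>x. 0) \<in> X \<and>
     (\<forall>f\<in>X. \<forall>g\<in>X. (\<lambda>x. f x + g x) \<in> X) \<and>
     (\<forall>a. \<forall>f\<in>X. (\<lambda>x. a * f x) \<in> X) \<and>
     (\<forall>f\<in>X. 0 \<le> N f) \<and>
     (\<forall>f\<in>X. N f = 0 \<longleftrightarrow> (AE x in M. f x = 0)) \<and>
     (\<forall>a. \<forall>f\<in>X. N (\<lambda>x. a * f x) = \<bar>a\<bar> * N f) \<and>
     (\<exists>k. \<forall>f\<in>X. \<forall>g\<in>X. N (\<lambda>x. f x + g x) \<le> k * (N f + N g))"

definition complete_rv_space ::
    "('a \<Rightarrow> real) set \<Rightarrow> (('a \<Rightarrow> real) \<Rightarrow> real) \<Rightarrow> bool" where
  "complete_rv_space X N \<longleftrightarrow>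
     (\<forall>u. (\<forall>n::nat. u n \<in> X) \<and>
          (\<forall>e>0. \<exists>n0. \<forall>m\<ge>n0. \<forall>n\<ge>n0. N (\<lambda>x. u m x - u n x) < e) \<longrightarrow>
          (\<exists>h\<in>X. (\<lambda>n. N (\<lambda>x. u n x - h x)) \<longlonglongrightarrow> 0))"

definition ri_monotone ::
    "'a measure \<Rightarrow> ('a \<Rightarrow> real) set \<Rightarrow> (('a \<Rightarrow> real) \<Rightarrow> real) \<Rightarrow> bool" where
  "ri_monotone M X N \<longleftrightarrow>
     (\<forall>f\<in>X. \<forall>g\<in>borel_measurable M.
        (\<forall>s\<in>{0..1}. rearr M g s \<le> rearr M f s) \<longrightarrow> g \<in> X \<and> N g \<le> N f)"

(* "Finite support" means support of finite measure. *)
definition contains_simple :: "'a measure \<Rightarrow> ('a \<Rightarrow> real) set \<Rightarrow> bool" where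
  "contains_simple M X \<longleftrightarrow>
     (\<forall>f. simple_function M f \<and> emeasure M {x \<in> space M. f x \<noteq> 0} < \<infinity> \<longrightarrow> f \<in> X)"

definition order_continuous_qnorm ::
    "'a measure \<Rightarrow> ('a \<Rightarrow> real) set \<Rightarrow> (('a \<Rightarrow> real) \<Rightarrow> real) \<Rightarrow> bool" where
  "order_continuous_qnorm M X N \<longleftrightarrow>
     (\<forall>u. (\<forall>n::nat. u n \<in> X) \<and> (AE x in M. decseq (\<lambda>n. u n x) \<and> (\<lambda>n. u n x) \<longlonglongrightarrow> 0) \<longrightarrow>
          decseq (\<lambda>n. N (u n)) \<and> (\<lambda>n. N (u n)) \<longlonglongrightarrow> 0)"

definition fatou_qnorm ::
    "'a measure \<Rightarrow> ('a \<Rightarrow> real) set \<Rightarrow> (('a \<Rightarrow> real) \<Rightarrow> real) \<Rightarrow> bool" where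
  "fatou_qnorm M X N \<longleftrightarrow>
     (\<forall>u. \<forall>f\<in>borel_measurable M.
        (\<forall>n::nat. u n \<in> X) \<and>
        (AE x in M. (\<forall>n. 0 \<le> u n x) \<and> incseq (\<lambda>n. u n x) \<and> (\<lambda>n. u n x) \<longlonglongrightarrow> f x) \<and>
        bdd_above (range (\<lambda>n. N (u n))) \<longrightarrow>
        f \<in> X \<and> N f = (SUP n. N (u n)))"

definition ri_space ::
    "'a measure \<Rightarrow> ('a \<Rightarrow> real) set \<Rightarrow> (('a \<Rightarrow> real) \<Rightarrow> real) \<Rightarrow> bool" where
  "ri_space M X N \<longleftrightarrow>
     quasi_normed_rv_space M X N \<and> complete_rv_space X N \<and>
     ri_monotone M X N \<and> contains_simple M X \<and>
     (order_continuous_qnorm M X N \<or> fatou_qnorm M X N)"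

definition ext_norm ::
    "('a \<Rightarrow> real) set \<Rightarrow> (('a \<Rightarrow> real) \<Rightarrow> real) \<Rightarrow> ('a \<Rightarrow> real) \<Rightarrow> ennreal" where
  "ext_norm X N f = (if f \<in> X then ennreal (N f) else \<infinity>)"

definition K_interp_bound ::
    "'a measure \<Rightarrow> real \<Rightarrow> real \<Rightarrow> ('a \<Rightarrow> real) set \<Rightarrow> (('a \<Rightarrow> real) \<Rightarrow> real) \<Rightarrow> real \<Rightarrow> bool" where
  "K_interp_bound M p q X N c \<longleftrightarrow>
     (\<forall>f\<in>borel_measurable M. \<forall>g\<in>X.
        (\<forall>t>0. K_functional M p q f t \<le> K_functional M p q g t) \<longrightarrow>
        f \<in> X \<and> N f \<le> c * N g)"

definition K_interp_space ::
    "'a measure \<Rightarrow> real \<Rightarrow> real \<Rightarrow> ('a \<Rightarrow> real) set \<Rightarrow> (('a \<Rightarrow> real) \<Rightarrow> real) \<Rightarrow> bool" where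
  "K_interp_space M p q X N \<longleftrightarrow> ri_space M X N \<and> (\<exists>c. K_interp_bound M p q X N c)"

(* On a probability space every admissible c is at least 1 (take f = g = 1), so for a
   K-interpolation space this is a genuine infimum. *)
definition K_interp_const ::
    "'a measure \<Rightarrow> real \<Rightarrow> real \<Rightarrow> ('a \<Rightarrow> real) set \<Rightarrow> (('a \<Rightarrow> real) \<Rightarrow> real) \<Rightarrow> real" where
  "K_interp_const M p q X N = Inf {c. K_interp_bound M p q X N c}"

end

theory Submission
  imports Defs
begin

text \<open>
  For fixed t the K-functional is equivalent to the Orlicz norm of
  \<open>\<Phi>(x) = min (x\<^sup>p) ((tx)\<^sup>q)\<close>, which lies in both growth classes.
  If \<open>E \<Phi>(|f|/r) \<le> 1\<close>, splitting the rearrangement according to which term of the minimum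
  is attained gives \<open>K(f,t) \<le> 2r\<close>. Conversely, if the rearrangement of g is \<open>u + v\<close> with
  \<open>\<parallel>u\<parallel>\<^sub>p + t \<parallel>v\<parallel>\<^sub>q \<le> R\<close>, then \<open>\<Phi>((u+v)/r) \<le> (2|u|/r)\<^sup>p + (2t|v|/r)\<^sup>q\<close>, and
  \<open>r = 2\<^bsup>1+1/p\<^esup> R\<close> makes each of the two integrals at most 1/2. The product of the two
  constants is \<open>2\<^bsup>2+1/p\<^esup>\<close>.
\<close>

section \<open>The decreasing rearrangement and its equimeasurability with |f|\<close>

text \<open>Distribution functions are right-continuous, so a tail probability above s at level t is
  still above s at some level beyond t. Superlevel sets of the rearrangement are thereby initial
  segments of the unit interval, which yields both its measurability and its law.\<close>

lemma rearr_gt_iff: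
  assumes "finite_measure M" and f: "f \<in> borel_measurable M" and "0 \<le> t"
  shows "ennreal t < rearr M f s \<longleftrightarrow> s < measure M {x \<in> space M. \<bar>f x\<bar> > t}"
proof
  interpret finite_measure M by fact
  assume "ennreal t < rearr M f s"
  then obtain t' where t': "0 \<le> t'" "s < measure M {x \<in> space M. \<bar>f x\<bar> > t'}"
      "ennreal t < ennreal t'"
    by (auto simp: rearr_def less_SUP_iff)
  then have "t < t'"
    by (simp add: ennreal_less_iff \<open>0 \<le> t\<close>)
  then have "measure M {x \<in> space M. \<bar>f x\<bar> > t'} \<le> measure M {x \<in> space M. \<bar>f x\<bar> > t}"
    using f by (intro finite_measure_mono) auto
  with t' show "s < measure M {x \<in> space M. \<bar>f x\<bar> > t}"
    by simp
next
  interpret finite_measure M by fact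
  \<comment> \<open>These events increase to {|f| > t}, so continuity from below supplies a level
    strictly above t.\<close>
  let ?A = "\<lambda>n::nat. {x \<in> space M. \<bar>f x\<bar> > t + 1 / Suc n}"
  assume *: "s < measure M {x \<in> space M. \<bar>f x\<bar> > t}"
  have "range ?A \<subseteq> sets M"
    using f by auto
  moreover have "incseq ?A"
  proof (rule incseq_SucI, safe)
    fix n x assume "t + 1 / real (Suc n) < \<bar>f x\<bar>"
    moreover have "1 / real (Suc (Suc n)) \<le> 1 / real (Suc n)"
      by (simp add: field_simps)
    ultimately show "t + 1 / real (Suc (Suc n)) < \<bar>f x\<bar>"
      by linarith
  qed
  ultimately have "(\<lambda>n. measure M (?A n)) \<longlonglongrightarrow> measure M (\<Union>n. ?A n)"
    by (rule finite_Lim_measure_incseq)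
  also have "(\<Union>n. ?A n) = {x \<in> space M. \<bar>f x\<bar> > t}"
  proof safe
    fix x n assume "t + 1 / real (Suc n) < \<bar>f x\<bar>"
    moreover have "0 < 1 / real (Suc n)" by simp
    ultimately show "t < \<bar>f x\<bar>" by linarith
  next
    fix x assume "x \<in> space M" "t < \<bar>f x\<bar>"
    then obtain n where "1 / real (Suc n) < \<bar>f x\<bar> - t"
      using nat_approx_posE[of "\<bar>f x\<bar> - t"] by auto
    then show "x \<in> (\<Union>n. ?A n)"
      using \<open>x \<in> space M\<close> by (auto intro!: exI[of _ n])
  qed
  finally have "\<forall>\<^sub>F n in sequentially. s < measure M (?A n)"
    using * by (rule order_tendstoD)
  then obtain n where "s < measure M (?A n)"
    by (auto simp: eventually_sequentially)
  moreover have "ennreal t < ennreal (t + 1 / Suc n)"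
    using \<open>0 \<le> t\<close> by (simp add: ennreal_less_iff)
  ultimately show "ennreal t < rearr M f s"
    using \<open>0 \<le> t\<close> unfolding rearr_def less_SUP_iff
    by (intro bexI[of _ "t + 1 / Suc n"]) auto
qed

lemma prob_space_unit_interval: "prob_space unit_interval_measure"
  by (rule prob_spaceI) (simp add: emeasure_restrict_space)

lemma measure_lessThan_unit_interval:
  assumes "0 \<le> m" "m \<le> 1"
  shows "{s \<in> {0..1::real}. s < m} \<in> sets unit_interval_measure"
    and "measure unit_interval_measure {s \<in> {0..1}. s < m} = m"
proof -
  have eq: "{s \<in> {0..1::real}. s < m} = {0..<m}"
    using assms by auto
  show "{s \<in> {0..1::real}. s < m} \<in> sets unit_interval_measure"
    unfolding eq using assms by (subst sets_restrict_space_iff) auto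
  show "measure unit_interval_measure {s \<in> {0..1}. s < m} = m"
    unfolding eq using assms by (subst measure_restrict_space) auto
qed

lemma measurable_rearr:
  assumes "prob_space M" and f: "f \<in> borel_measurable M"
  shows "rearr M f \<in> borel_measurable unit_interval_measure"
proof (rule borel_measurableI_greater)
  interpret prob_space M by fact
  fix y :: ennreal
  show "{s \<in> space unit_interval_measure. y < rearr M f s} \<in> sets unit_interval_measure"
  proof (cases y)
    case (real t)
    then show ?thesis
      using measure_lessThan_unit_interval(1)[of "prob {x \<in> space M. t < \<bar>f x\<bar>}"]
      by (simp add: rearr_gt_iff f finite_measure_axioms)
  qed simp
qed

text \<open>Tail probabilities of the real-valued f tend to 0, so for s > 0 some level n has tail
  below s and bounds the rearrangement there. Only s = 0 can carry an infinite value, and that point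
  is null.\<close>

lemma AE_rearr_finite:
  assumes "prob_space M" and f: "f \<in> borel_measurable M"
  shows "AE s in unit_interval_measure. ennreal (enn2real (rearr M f s)) = rearr M f s"
proof -
  interpret prob_space M by fact
  have fin: "rearr M f s < \<infinity>" if s: "0 < s" for s
  proof -
    let ?A = "\<lambda>n::nat. {x \<in> space M. \<bar>f x\<bar> > real n}"
    have "(\<lambda>n. prob (?A n)) \<longlonglongrightarrow> prob (\<Inter>n. ?A n)"
      using f by (intro finite_Lim_measure_decseq) (auto simp: decseq_def)
    also have "(\<Inter>n. ?A n) = {}"
    proof -
      have "\<exists>n. \<not> real n < \<bar>f x\<bar>" for x
        using real_arch_simple[of "\<bar>f x\<bar>"] by (auto simp: not_less)
      then show ?thesis by auto
    qed
    finally have "\<forall>\<^sub>F n in sequentially. prob (?A n) < s"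
      using s by (intro order_tendstoD) auto
    then obtain n where "prob (?A n) < s"
      by (auto simp: eventually_sequentially)
    then have "\<not> ennreal (real n) < rearr M f s"
      by (simp add: rearr_gt_iff f finite_measure_axioms del: ennreal_of_nat_eq_real_of_nat)
    then show ?thesis
      by (metis ennreal_less_top infinity_ennreal_def leI order_le_less_trans)
  qed
  have "AE s in lebesgue. s \<noteq> (0::real)"
    by (rule AE_completion[OF AE_lborel_singleton])
  then have "AE s in unit_interval_measure. s \<noteq> (0::real)"
    by (subst AE_restrict_space_iff) auto
  moreover have "AE s in unit_interval_measure. s \<in> {0..1::real}"
    by (rule AE_I2) simp
  ultimately show ?thesis
  proof eventually_elim
    case (elim s)
    then show ?case using fin[of s] by simp
  qed
qed

text \<open>The set where the rearrangement exceeds t >= 0 is, up to a null set, the initial segment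
  of length P(|f| > t). Hence the two laws have the same tails, and therefore the same distribution
  functions.\<close>

lemma distr_rearr:
  assumes "prob_space M" and f: "f \<in> borel_measurable M"
  shows "distr unit_interval_measure borel (\<lambda>s. enn2real (rearr M f s))
           = distr M borel (\<lambda>x. \<bar>f x\<bar>)" (is "?L = ?R")
proof (rule cdf_unique)
  interpret prob_space M by fact
  interpret U: prob_space unit_interval_measure by (rule prob_space_unit_interval)
  let ?h = "\<lambda>s. enn2real (rearr M f s)"
  have h: "?h \<in> borel_measurable unit_interval_measure"
    using measurable_rearr[OF assms] by measurable
  interpret L: prob_space ?L using h by (rule U.prob_space_distr)
  interpret R: prob_space ?R using f by (intro prob_space_distr) auto
  show "real_distribution ?L" "real_distribution ?R"
    by (simp_all add: real_distribution_def real_distribution_axioms_def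
        L.prob_space_axioms R.prob_space_axioms)
  have tail: "measure ?L {t<..} = measure ?R {t<..}" for t
  proof (cases "0 \<le> t")
    case True
    have "measure ?L {t<..} = measure unit_interval_measure {s \<in> space unit_interval_measure. t < ?h s}"
      using h by (simp add: measure_distr) (intro arg_cong[where f="measure _"], auto)
    \<comment> \<open>The sets agree only almost everywhere: \<open>enn2real\<close> sends a
      possible infinite value at s = 0 to 0.\<close>
    also have "\<dots> = measure unit_interval_measure {s \<in> {0..1}. s < prob {x \<in> space M. \<bar>f x\<bar> > t}}"
    proof (rule U.finite_measure_eq_AE)
      show "AE s in unit_interval_measure. (s \<in> {s \<in> space unit_interval_measure. t < ?h s})
          = (s \<in> {s \<in> {0..1}. s < prob {x \<in> space M. \<bar>f x\<bar> > t}})"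
        using AE_rearr_finite[OF assms]
      proof eventually_elim
        case (elim s)
        have "t < ?h s \<longleftrightarrow> ennreal t < rearr M f s"
          using True by (subst elim[symmetric]) (simp add: ennreal_less_iff)
        then show ?case
          by (simp add: rearr_gt_iff f finite_measure_axioms True)
      qed
      show "{s \<in> space unit_interval_measure. t < ?h s} \<in> sets unit_interval_measure"
        using h by measurable
    qed (intro measure_lessThan_unit_interval(1) measure_nonneg prob_le_1)
    also have "\<dots> = prob {x \<in> space M. \<bar>f x\<bar> > t}"
      by (rule measure_lessThan_unit_interval(2)) auto
    also have "\<dots> = measure ?R {t<..}"
      using f by (simp add: measure_distr) (intro arg_cong[where f=prob], auto)
    finally show ?thesis .
  next
    case False
    \<comment> \<open>For t < 0 both tails have full mass, since both functions are
      nonnegative.\<close>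
    have "measure ?L {t<..} = measure ?L (space ?L)"
      using False by (intro L.finite_measure_eq_AE)
        (auto simp: AE_distr_iff h intro!: AE_I2 less_le_trans[OF _ enn2real_nonneg])
    moreover have "measure ?R {t<..} = measure ?R (space ?R)"
      using False f by (intro R.finite_measure_eq_AE) (auto simp: AE_distr_iff)
    ultimately show ?thesis
      using L.prob_space R.prob_space by simp
  qed
  show "cdf ?L = cdf ?R"
  proof
    fix t :: real
    have eq: "{..t} = UNIV - {t<..}" by (auto simp: not_less)
    show "cdf ?L t = cdf ?R t"
      using L.prob_compl[of "{t<..}"] R.prob_compl[of "{t<..}"] tail[of t]
      by (simp add: cdf_def eq)
  qed
qed

lemma nn_integral_rearr:
  assumes "prob_space M" and f: "f \<in> borel_measurable M" and \<Phi>: "\<Phi> \<in> borel_measurable borel"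
  shows "(\<integral>\<^sup>+x. \<Phi> \<bar>f x\<bar> \<partial>M) = (\<integral>\<^sup>+s. \<Phi> (enn2real (rearr M f s)) \<partial>unit_interval_measure)"
proof -
  have h: "(\<lambda>s. enn2real (rearr M f s)) \<in> borel_measurable unit_interval_measure"
    using measurable_rearr[OF assms(1,2)] by measurable
  have "(\<integral>\<^sup>+x. \<Phi> \<bar>f x\<bar> \<partial>M) = (\<integral>\<^sup>+y. \<Phi> y \<partial>distr M borel (\<lambda>x. \<bar>f x\<bar>))"
    using f \<Phi> by (subst nn_integral_distr) auto
  also have "\<dots> = (\<integral>\<^sup>+s. \<Phi> (enn2real (rearr M f s)) \<partial>unit_interval_measure)"
    unfolding distr_rearr[OF assms(1,2), symmetric] using h \<Phi> by (subst nn_integral_distr) auto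
  finally show ?thesis .
qed

section \<open>Power integrals and the Orlicz functions \<open>min_powr\<close>\<close>

text \<open>Allows every later norm estimate to be carried out on integrals, with the root and the
  infinite case handled once.\<close>

lemma Lp_qnorm_le_iff:
  assumes "0 < p" "0 \<le> a"
  shows "Lp_qnorm M p h \<le> ennreal a \<longleftrightarrow> (\<integral>\<^sup>+x. ennreal (\<bar>h x\<bar> powr p) \<partial>M) \<le> ennreal (a powr p)"
proof (cases "\<integral>\<^sup>+x. ennreal (\<bar>h x\<bar> powr p) \<partial>M")
  case (real I)
  have "I powr (1 / p) \<le> a \<longleftrightarrow> I \<le> a powr p"
  proof
    assume "I powr (1 / p) \<le> a"
    then have "(I powr (1 / p)) powr p \<le> a powr p"
      using assms by (intro powr_mono2) auto
    then show "I \<le> a powr p"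
      using assms real by (simp add: powr_powr)
  next
    assume "I \<le> a powr p"
    then have "I powr (1 / p) \<le> (a powr p) powr (1 / p)"
      using assms real by (intro powr_mono2) auto
    then show "I powr (1 / p) \<le> a"
      using assms by (simp add: powr_powr)
  qed
  with real assms show ?thesis
    by (simp add: Lp_qnorm_def)
next
  case top
  then show ?thesis by (simp add: Lp_qnorm_def top_unique)
qed

definition min_powr :: "real \<Rightarrow> real \<Rightarrow> real \<Rightarrow> real \<Rightarrow> real" where
  "min_powr p q t x = min (x powr p) ((t * x) powr q)"

lemma measurable_min_powr [measurable]: "min_powr p q t \<in> borel_measurable borel"
  unfolding min_powr_def by measurable

lemma min_powr_nonneg [simp]: "0 \<le> min_powr p q t x"
  by (simp add: min_powr_def)

text \<open>Scaling the argument by c multiplies the two terms of the minimum by c^p and c^q. As c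
  >= 1 and p < q, replacing both factors by the larger one gives the upper growth bound, and by the
  smaller one the lower bound.\<close>

lemma min_powr_in_classes:
  assumes "0 < p" "p < q" "0 < t"
  shows "min_powr p q t \<in> F_class q \<inter> G_class p"
proof -
  have mono: "mono_on {0..} (min_powr p q t)"
    unfolding min_powr_def using assms by (intro mono_onI min.mono powr_mono2 mult_left_mono) auto
  have cont: "continuous_on {0..} (min_powr p q t)"
    unfolding min_powr_def using assms
    by (intro continuous_on_min continuous_on_powr' continuous_intros) auto
  have growth: "growth_fun (min_powr p q t)"
    using mono cont by (simp add: growth_fun_def) (simp add: min_powr_def)
  have c_pq: "c powr p \<le> c powr q" if "2 \<le> c" for c :: real
    using assms that by (intro powr_mono) auto
  have scale: "min_powr p q t (c * x) = min (c powr p * x powr p) (c powr q * (t * x) powr q)"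
    if "0 \<le> x" "2 \<le> c" for c x
    using that assms by (simp add: min_powr_def powr_mult algebra_simps)
  have "min_powr p q t (c * x) \<le> c powr q * min_powr p q t x" if "0 \<le> x" "2 \<le> c" for c x
  proof -
    have "min_powr p q t (c * x) \<le> min (c powr q * x powr p) (c powr q * (t * x) powr q)"
      unfolding scale[OF that] using c_pq[OF that(2)] by (intro min.mono mult_right_mono) auto
    then show ?thesis
      by (simp add: min_powr_def min_mult_distrib_left)
  qed
  moreover have "c powr p * min_powr p q t x \<le> min_powr p q t (c * x)" if "0 \<le> x" "2 \<le> c" for c x
  proof -
    have "min (c powr p * x powr p) (c powr p * (t * x) powr q) \<le> min_powr p q t (c * x)"
      unfolding scale[OF that] using c_pq[OF that(2)] by (intro min.mono mult_right_mono) auto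
    then show ?thesis
      by (simp add: min_powr_def min_mult_distrib_left)
  qed
  ultimately show ?thesis
    using growth by (auto simp: F_class_def G_class_def)
qed

section \<open>Two-sided comparison of the K-functional with the Orlicz norm\<close>

lemma K_functional_le_orlicz_norm:
  assumes "prob_space M" and f: "f \<in> borel_measurable M" and pq: "0 < p" "p < q" and t: "0 < t"
  shows "K_functional M p q f t \<le> 2 * orlicz_norm M (min_powr p q t) f"
proof -
  let ?U = unit_interval_measure
  let ?\<Phi> = "min_powr p q t"
  define h where "h = (\<lambda>s. enn2real (rearr M f s))"
  have h [measurable]: "h \<in> borel_measurable ?U"
    unfolding h_def using measurable_rearr[OF assms(1,2)] by measurable
  have h0: "0 \<le> h s" for s by (simp add: h_def)
  \<comment> \<open>The bound is proved for each admissible r separately; the infimum over r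
    follows, including the case where no r is admissible.\<close>
  have "K_functional M p q f t / 2 \<le> ennreal r"
    if r: "0 < r" and le: "(\<integral>\<^sup>+x. ennreal (?\<Phi> (\<bar>f x\<bar> / r)) \<partial>M) \<le> 1" for r
  proof -
    \<comment> \<open>On the set where f' keeps h, the minimum is the p-th power; on the complement,
      where f'' keeps h, it is the q-th power. Each piece is thus controlled pointwise by
      \<open>?\<Phi> (h s / r)\<close>.\<close>
    define f' where "f' = (\<lambda>s. if (h s / r) powr p \<le> (t * (h s / r)) powr q then h s else 0)"
    define f'' where "f'' = (\<lambda>s. if (h s / r) powr p \<le> (t * (h s / r)) powr q then 0 else h s)"
    have meas: "f' \<in> borel_measurable ?U" "f'' \<in> borel_measurable ?U"
      unfolding f'_def f''_def by measurable
    have int: "(\<integral>\<^sup>+s. ennreal (?\<Phi> (h s / r)) \<partial>?U) \<le> 1"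
      using le nn_integral_rearr[OF assms(1,2), of "\<lambda>y. ennreal (?\<Phi> (y / r))"]
      by (simp add: h_def)
    \<comment> \<open>Used twice: with exponent p and a = r for f', and with exponent q and a = r /
      t for f''. The weight t in the K-functional turns r / t back into r, so the total is
      2r.\<close>
    have bound: "Lp_qnorm ?U e k \<le> ennreal a"
      if e: "0 < e" and a: "0 < a" and k: "\<And>s. \<bar>k s\<bar> powr e \<le> a powr e * ?\<Phi> (h s / r)" for e a k
    proof -
      have "(\<integral>\<^sup>+s. ennreal (\<bar>k s\<bar> powr e) \<partial>?U) \<le> (\<integral>\<^sup>+s. ennreal (a powr e) * ennreal (?\<Phi> (h s / r)) \<partial>?U)"
        using k by (intro nn_integral_mono) (simp add: ennreal_mult[symmetric])
      also have "\<dots> = ennreal (a powr e) * (\<integral>\<^sup>+s. ennreal (?\<Phi> (h s / r)) \<partial>?U)"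
        by (rule nn_integral_cmult) measurable
      also have "\<dots> \<le> ennreal (a powr e) * 1"
        by (intro mult_left_mono int) auto
      finally show ?thesis
        using e a by (simp add: Lp_qnorm_le_iff)
    qed
    have f': "Lp_qnorm ?U p f' \<le> ennreal r"
    proof (rule bound)
      fix s show "\<bar>f' s\<bar> powr p \<le> r powr p * ?\<Phi> (h s / r)"
        using h0[of s] r by (auto simp: f'_def min_powr_def powr_divide)
    qed (use pq r in auto)
    have f'': "Lp_qnorm ?U q f'' \<le> ennreal (r / t)"
    proof (rule bound)
      fix s show "\<bar>f'' s\<bar> powr q \<le> (r / t) powr q * ?\<Phi> (h s / r)"
        using h0[of s] r t by (auto simp: f''_def min_powr_def powr_divide powr_mult)
    qed (use pq r t in auto)
    have "K_functional M p q f t \<le> Lp_qnorm ?U p f' + ennreal t * Lp_qnorm ?U q f''"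
      unfolding K_functional_def
    proof (rule INF_lower2[of "(f', f'')"])
      have "AE s in ?U. ereal (f' s + f'' s) = enn2ereal (rearr M f s)"
        using AE_rearr_finite[OF assms(1,2)]
      proof eventually_elim
        case (elim s)
        have "f' s + f'' s = h s" by (simp add: f'_def f''_def)
        then show ?case
          using h0[of s] by (subst elim[symmetric]) (simp add: h_def enn2ereal_ennreal)
      qed
      then show "(f', f'') \<in> {(f', f''). f' \<in> borel_measurable ?U \<and> f'' \<in> borel_measurable ?U \<and>
          (AE s in ?U. ereal (f' s + f'' s) = enn2ereal (rearr M f s))}"
        using meas by simp
    qed simp
    also have "\<dots> \<le> ennreal r + ennreal t * ennreal (r / t)"
      by (intro add_mono mult_left_mono f' f'') auto
    also have "\<dots> = 2 * ennreal r"
      using r t by (simp add: ennreal_mult[symmetric] mult_2)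
    finally have "K_functional M p q f t / 2 \<le> ennreal r * 2 / 2"
      by (intro divide_right_mono_ennreal) (simp add: mult.commute)
    then show ?thesis
      by (simp add: mult_divide_eq_ennreal)
  qed
  then have "K_functional M p q f t / 2 \<le> orlicz_norm M ?\<Phi> f"
    unfolding orlicz_norm_def by (intro INF_greatest) auto
  then have "K_functional M p q f t / 2 * 2 \<le> orlicz_norm M ?\<Phi> f * 2"
    by (rule mult_right_mono) simp
  moreover have "K_functional M p q f t / 2 * 2 = K_functional M p q f t"
    by (subst ennreal_divide_times) simp
  ultimately show ?thesis
    by (simp only: mult.commute[of 2])
qed

text \<open>Since x is at most twice the larger of |a| and |b|, the minimum can be bounded by its
  p-term when |a| dominates and by its q-term when |b| does.\<close>

lemma min_powr_add_le:
  assumes "0 < p" "p < q" "0 < t" "0 \<le> x" "x \<le> \<bar>a\<bar> + \<bar>b\<bar>"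
  shows "min_powr p q t x \<le> (2 * \<bar>a\<bar>) powr p + (t * (2 * \<bar>b\<bar>)) powr q"
proof (cases "\<bar>b\<bar> \<le> \<bar>a\<bar>")
  case True
  then have "x powr p \<le> (2 * \<bar>a\<bar>) powr p"
    using assms by (intro powr_mono2) auto
  then show ?thesis
    by (simp add: min_powr_def min.coboundedI1 add_increasing2)
next
  case False
  then have "(t * x) powr q \<le> (t * (2 * \<bar>b\<bar>)) powr q"
    using assms by (intro powr_mono2 mult_left_mono) auto
  then show ?thesis
    by (simp add: min_powr_def min.coboundedI2 add_increasing)
qed

lemma orlicz_norm_le_K_functional:
  assumes "prob_space M" and g: "g \<in> borel_measurable M" and pq: "0 < p" "p < q" and t: "0 < t"
  shows "orlicz_norm M (min_powr p q t) g \<le> ennreal (2 powr (1 + 1 / p)) * K_functional M p q g t"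
proof -
  let ?U = unit_interval_measure
  let ?\<Phi> = "min_powr p q t"
  let ?C = "2 powr (1 + 1 / p) :: real"
  have C: "0 < ?C" by simp
  \<comment> \<open>R is any positive real bound on the cost of one decomposition. It must be
    positive so that \<open>?C * R\<close> is an admissible radius in the Orlicz norm.\<close>
  have le: "orlicz_norm M ?\<Phi> g \<le> ennreal (?C * R)"
    if [measurable]: "u \<in> borel_measurable ?U" "v \<in> borel_measurable ?U"
      and sum: "AE s in ?U. ereal (u s + v s) = enn2ereal (rearr M g s)"
      and R: "0 < R" and nu: "Lp_qnorm ?U p u + ennreal t * Lp_qnorm ?U q v \<le> ennreal R"
    for u v R
  proof -
    define r where "r = ?C * R"
    have r: "0 < r" using R by (simp add: r_def)
    have "Lp_qnorm ?U p u \<le> ennreal R"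
      using nu by (rule order_trans[rotated]) (simp add: add_increasing2)
    then have u: "(\<integral>\<^sup>+s. ennreal (\<bar>u s\<bar> powr p) \<partial>?U) \<le> ennreal (R powr p)"
      using pq R by (simp add: Lp_qnorm_le_iff)
    have tv: "ennreal t * Lp_qnorm ?U q v \<le> ennreal R"
      using nu by (rule order_trans[rotated]) (simp add: add_increasing)
    have "Lp_qnorm ?U q v = ennreal (1 / t) * (ennreal t * Lp_qnorm ?U q v)"
      using t by (simp add: mult.assoc[symmetric] ennreal_mult[symmetric])
    also have "\<dots> \<le> ennreal (1 / t) * ennreal R"
      by (intro mult_left_mono tv) simp
    also have "\<dots> = ennreal (R / t)"
      using t R by (simp add: ennreal_mult[symmetric])
    finally have v: "(\<integral>\<^sup>+s. ennreal (\<bar>v s\<bar> powr q) \<partial>?U) \<le> ennreal ((R / t) powr q)"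
      using pq R t by (simp add: Lp_qnorm_le_iff)
    have "(\<integral>\<^sup>+x. ennreal (?\<Phi> (\<bar>g x\<bar> / r)) \<partial>M) = (\<integral>\<^sup>+s. ennreal (?\<Phi> (enn2real (rearr M g s) / r)) \<partial>?U)"
      by (rule nn_integral_rearr[OF assms(1,2)]) measurable
    also have "\<dots> \<le> (\<integral>\<^sup>+s. ennreal ((2 / r) powr p) * ennreal (\<bar>u s\<bar> powr p)
        + ennreal ((2 * t / r) powr q) * ennreal (\<bar>v s\<bar> powr q) \<partial>?U)"
    proof (rule nn_integral_mono_AE)
      show "AE s in ?U. ennreal (?\<Phi> (enn2real (rearr M g s) / r)) \<le>
          ennreal ((2 / r) powr p) * ennreal (\<bar>u s\<bar> powr p)
          + ennreal ((2 * t / r) powr q) * ennreal (\<bar>v s\<bar> powr q)"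
        using sum AE_rearr_finite[OF assms(1,2)]
      proof eventually_elim
        case (elim s)
        let ?h = "enn2real (rearr M g s)"
        \<comment> \<open>At points of finiteness the extended-real identity becomes a real one.
          Since u and v may change sign, only |u| + |v| is used from here on.\<close>
        have "enn2ereal (rearr M g s) = ereal ?h"
          by (subst elim(2)[symmetric]) (simp add: enn2ereal_ennreal)
        then have "?h = u s + v s"
          using elim(1) by simp
        then have "?h / r \<le> \<bar>u s / r\<bar> + \<bar>v s / r\<bar>"
          using r by (simp add: abs_divide add_divide_distrib[symmetric] divide_right_mono)
        then have "?\<Phi> (?h / r) \<le> (2 * \<bar>u s / r\<bar>) powr p + (t * (2 * \<bar>v s / r\<bar>)) powr q"
          using pq t r by (intro min_powr_add_le) auto
        also have "2 * \<bar>u s / r\<bar> = 2 / r * \<bar>u s\<bar>"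
          using r by (simp add: abs_divide)
        also have "t * (2 * \<bar>v s / r\<bar>) = 2 * t / r * \<bar>v s\<bar>"
          using r by (simp add: abs_divide)
        also have "(2 / r * \<bar>u s\<bar>) powr p = (2 / r) powr p * \<bar>u s\<bar> powr p"
          using r by (intro powr_mult)
        also have "(2 * t / r * \<bar>v s\<bar>) powr q = (2 * t / r) powr q * \<bar>v s\<bar> powr q"
          using r t by (intro powr_mult)
        finally show ?case
          by (simp add: ennreal_mult[symmetric] ennreal_plus[symmetric] del: ennreal_plus)
      qed
    qed
    also have "\<dots> = ennreal ((2 / r) powr p) * (\<integral>\<^sup>+s. ennreal (\<bar>u s\<bar> powr p) \<partial>?U)
        + ennreal ((2 * t / r) powr q) * (\<integral>\<^sup>+s. ennreal (\<bar>v s\<bar> powr q) \<partial>?U)"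
      by (simp add: nn_integral_add nn_integral_cmult)
    also have "\<dots> \<le> ennreal ((2 / r) powr p) * ennreal (R powr p)
        + ennreal ((2 * t / r) powr q) * ennreal ((R / t) powr q)"
      by (intro add_mono mult_left_mono u v) auto
    also have "\<dots> = ennreal ((2 / r * R) powr p + (2 * t / r * (R / t)) powr q)"
      unfolding powr_mult[of "2 / r" R] powr_mult[of "2 * t / r" "R / t"]
      by (simp only: ennreal_plus ennreal_mult powr_ge_zero mult_nonneg_nonneg)
    also have "\<dots> \<le> 1"
    proof -
      \<comment> \<open>Both bases equal 2 / \<open>?C\<close> = 2^(-1/p). Its p-th power is exactly
        1/2, and its q-th power 2^(-q/p) is at most 1/2 because q > p.\<close>
      have "2 / ?C = 2 powr (- (1 / p))"
        using powr_diff[of 2 1 "1 + 1 / p"] by simp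
      moreover have "2 / r * R = 2 / ?C" "2 * t / r * (R / t) = 2 / ?C"
        using R t by (simp_all add: r_def)
      ultimately have eq: "2 / r * R = 2 powr (- (1 / p))" "2 * t / r * (R / t) = 2 powr (- (1 / p))"
        by simp_all
      have "(2 powr (- (1 / p))) powr p = (2::real) powr (-1)"
        unfolding powr_powr using pq by simp
      moreover have "(2 powr (- (1 / p))) powr q \<le> (2::real) powr (-1)"
        unfolding powr_powr using pq by (intro powr_mono) (auto simp: field_simps)
      ultimately show ?thesis
        unfolding eq by (simp add: powr_minus_divide del: ennreal_plus)
    qed
    finally show ?thesis
      unfolding orlicz_norm_def r_def[symmetric] using r by (intro INF_lower) auto
  qed
  have "orlicz_norm M ?\<Phi> g / ennreal ?C \<le> K_functional M p q g t"
    unfolding K_functional_def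
  proof (rule INF_greatest, clarify)
    fix u v
    assume uv: "u \<in> borel_measurable ?U" "v \<in> borel_measurable ?U"
      "AE s in ?U. ereal (u s + v s) = enn2ereal (rearr M g s)"
    show "orlicz_norm M ?\<Phi> g / ennreal ?C \<le> Lp_qnorm ?U p u + ennreal t * Lp_qnorm ?U q v"
      (is "_ \<le> ?k")
    \<comment> \<open>The cost k may be 0, so \<open>le\<close> is applied with k + e, which is
      positive.\<close>
    proof (rule ennreal_le_epsilon)
      fix e :: real assume "?k < top" and e: "0 < e"
      then obtain k where k: "?k = ennreal k" "0 \<le> k"
        by (cases ?k) auto
      then have "orlicz_norm M ?\<Phi> g \<le> ennreal (?C * (k + e))"
        using e uv by (intro le[of u v]) (auto simp: ennreal_leI)
      then have "orlicz_norm M ?\<Phi> g / ennreal ?C \<le> ennreal (?C * (k + e)) / ennreal ?C"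
        by (rule divide_right_mono_ennreal)
      also have "\<dots> = ennreal (k + e)"
        using k e by (subst divide_ennreal) auto
      also have "\<dots> = ?k + ennreal e"
        using k e by simp
      finally show "orlicz_norm M ?\<Phi> g / ennreal ?C \<le> ?k + ennreal e" .
    qed
  qed
  then have "ennreal ?C * (orlicz_norm M ?\<Phi> g / ennreal ?C) \<le> ennreal ?C * K_functional M p q g t"
    by (rule mult_left_mono) simp
  then show ?thesis
    by (simp add: ennreal_times_divide mult_divide_eq_ennreal mult.commute)
qed

section \<open>Transfer to the interpolation space\<close>

text \<open>If r is admissible for c g, then r / c is admissible for g.\<close>

lemma orlicz_norm_scale_le:
  assumes c: "0 < c"
  shows "ennreal c * orlicz_norm M \<Phi> g \<le> orlicz_norm M \<Phi> (\<lambda>x. c * g x)"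
  unfolding orlicz_norm_def[of M \<Phi> "\<lambda>x. c * g x"]
proof (rule INF_greatest, clarify)
  fix r :: real
  assume r: "0 < r" and le: "(\<integral>\<^sup>+x. ennreal (\<Phi> (\<bar>c * g x\<bar> / r)) \<partial>M) \<le> 1"
  have "\<bar>c * g x\<bar> / r = \<bar>g x\<bar> / (r / c)" for x
    using c r by (simp add: abs_mult)
  with le have "orlicz_norm M \<Phi> g \<le> ennreal (r / c)"
    unfolding orlicz_norm_def using c r by (intro INF_lower) auto
  then have "ennreal c * orlicz_norm M \<Phi> g \<le> ennreal c * ennreal (r / c)"
    by (rule mult_left_mono) simp
  also have "\<dots> = ennreal r"
    using c r by (simp add: ennreal_mult[symmetric])
  finally show "ennreal c * orlicz_norm M \<Phi> g \<le> ennreal r" .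
qed

text \<open>The whole constant is put inside the argument g, because the interpolation property
  compares K-functionals without any factor. Scaling is done on the Orlicz norm, between the two
  comparison estimates.\<close>

lemma K_functional_mono_of_orlicz_norms:
  assumes "prob_space M" and pq: "0 < p" "p < q"
    and f: "f \<in> borel_measurable M" and g: "g \<in> borel_measurable M"
    and le: "\<And>\<Phi>. \<Phi> \<in> F_class q \<inter> G_class p \<Longrightarrow> orlicz_norm M \<Phi> f \<le> orlicz_norm M \<Phi> g"
    and t: "0 < t"
  shows "K_functional M p q f t \<le> K_functional M p q (\<lambda>x. 2 powr (2 + 1 / p) * g x) t"
proof -
  let ?\<Phi> = "min_powr p q t"
  let ?C = "2 powr (1 + 1 / p) :: real"
  let ?g = "\<lambda>x. 2 powr (2 + 1 / p) * g x"
  have C2: "2 powr (2 + 1 / p) = 2 * ?C"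
    using powr_add[of 2 1 "1 + 1 / p"] by simp
  \<comment> \<open>The factor \<open>?C\<close> is carried on the left so that it cancels against
    the one from the reverse comparison at the end; the product 2 * \<open>?C\<close> is absorbed
    into g.\<close>
  have "ennreal ?C * K_functional M p q f t \<le> ennreal ?C * (2 * orlicz_norm M ?\<Phi> f)"
    by (intro mult_left_mono K_functional_le_orlicz_norm assms) simp
  also have "\<dots> \<le> ennreal ?C * (2 * orlicz_norm M ?\<Phi> g)"
    by (intro mult_left_mono le min_powr_in_classes assms) auto
  also have "\<dots> = ennreal (2 powr (2 + 1 / p)) * orlicz_norm M ?\<Phi> g"
    by (simp add: C2 ennreal_mult mult_ac)
  also have "\<dots> \<le> orlicz_norm M ?\<Phi> ?g"
    by (rule orlicz_norm_scale_le) simp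
  also have "\<dots> \<le> ennreal ?C * K_functional M p q ?g t"
    using g by (intro orlicz_norm_le_K_functional assms) measurable
  finally show ?thesis
    by (subst (asm) ennreal_mult_le_mult_iff) auto
qed

text \<open>Test with f = g = 1, whose norm is nonzero on a probability space. This bounds the set
  of admissible constants below and makes their infimum positive.\<close>

lemma K_interp_bound_ge_1:
  assumes "prob_space M" "ri_space M X N" "K_interp_bound M p q X N c"
  shows "1 \<le> c"
proof -
  interpret prob_space M by fact
  let ?one = "\<lambda>x. 1 :: real"
  have X: "quasi_normed_rv_space M X N" "contains_simple M X"
    using assms(2) by (auto simp: ri_space_def)
  have one: "?one \<in> X"
    using X(2) unfolding contains_simple_def by (auto simp: emeasure_space_1)
  then have "N ?one \<noteq> 0" "0 \<le> N ?one"
    using X(1) by (auto simp: quasi_normed_rv_space_def)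
  moreover have "N ?one \<le> c * N ?one"
    using assms(3) one by (auto simp: K_interp_bound_def)
  ultimately show ?thesis
    by (simp add: mult_le_cancel_right1)
qed

theorem theorem1p3:
  fixes M :: "'a measure" and p q :: real and f g :: "'a \<Rightarrow> real"
    and X :: "('a \<Rightarrow> real) set" and N :: "('a \<Rightarrow> real) \<Rightarrow> real"
  assumes "prob_space M"
    and "0 < p" and "p < q"
    and "f \<in> borel_measurable M" and "g \<in> borel_measurable M"
    and "\<And>\<Phi>. \<Phi> \<in> F_class q \<inter> G_class p \<Longrightarrow> orlicz_norm M \<Phi> f \<le> orlicz_norm M \<Phi> g"
    and "K_interp_space M p q X N"
  shows "ext_norm X N f
           \<le> ennreal (2 powr (2 + 1 / p) * K_interp_const M p q X N) * ext_norm X N g"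
proof -
  let ?C = "2 powr (2 + 1 / p) :: real"
  let ?S = "{c. K_interp_bound M p q X N c}"
  have ri: "ri_space M X N" and ne: "?S \<noteq> {}"
    using assms(7) by (auto simp: K_interp_space_def)
  have const: "1 \<le> K_interp_const M p q X N"
    unfolding K_interp_const_def using ne K_interp_bound_ge_1[OF assms(1) ri]
    by (intro cInf_greatest) auto
  show ?thesis
  proof (cases "g \<in> X")
    case False
    \<comment> \<open>In ennreal, \<open>0 * \<infinity> = 0\<close>, so positivity of the constant matters here.\<close>
    have "ennreal (?C * K_interp_const M p q X N) \<noteq> 0"
      using const by (simp add: not_le)
    with False show ?thesis
      by (simp add: ext_norm_def ennreal_mult_top)
  next
    case True
    have qn: "quasi_normed_rv_space M X N"
      using ri by (simp add: ri_space_def)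
    have Cg: "(\<lambda>x. ?C * g x) \<in> X" "N (\<lambda>x. ?C * g x) = ?C * N g" and Ng: "0 \<le> N g"
      using qn True by (auto simp: quasi_normed_rv_space_def)
    have K_le: "\<forall>t>0. K_functional M p q f t \<le> K_functional M p q (\<lambda>x. ?C * g x) t"
      using K_functional_mono_of_orlicz_norms[OF assms(1-6)] by blast
    \<comment> \<open>The interpolation property is applied to f and \<open>?C * g\<close>;
      homogeneity of N then takes the constant out.\<close>
    have *: "f \<in> X" "N f \<le> c * (?C * N g)" if "c \<in> ?S" for c
    proof -
      have "\<forall>f\<in>borel_measurable M. \<forall>g\<in>X.
          (\<forall>t>0. K_functional M p q f t \<le> K_functional M p q g t) \<longrightarrow> f \<in> X \<and> N f \<le> c * N g"
        using that by (simp add: K_interp_bound_def)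
      from this[rule_format, OF assms(4) Cg(1)] K_le
      have "f \<in> X \<and> N f \<le> c * N (\<lambda>x. ?C * g x)"
        by blast
      then show "f \<in> X" "N f \<le> c * (?C * N g)"
        by (simp_all only: Cg(2))
    qed
    have f: "f \<in> X"
      using ne *(1) by auto
    have "N f \<le> ?C * K_interp_const M p q X N * N g"
    \<comment> \<open>Passing to the infimum over c requires dividing by \<open>?C * N g\<close>. If
      N g = 0, any single admissible c already gives N f <= 0.\<close>
    proof (cases "N g = 0")
      case True
      then show ?thesis using ne *(2) by auto
    next
      case False
      with Ng have pos: "0 < ?C * N g" by simp
      have "N f / (?C * N g) \<le> K_interp_const M p q X N"
        unfolding K_interp_const_def using ne *(2) pos
        by (intro cInf_greatest) (auto simp: pos_divide_le_eq)
      then show ?thesis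
        using pos by (simp add: pos_divide_le_eq mult_ac)
    qed
    then show ?thesis
      using f True Ng const by (simp add: ext_norm_def ennreal_mult[symmetric] ennreal_leI)
  qed
qed

end
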